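(* Let $\mathcal{L} \subseteq \mathbb{S}^n$ be a linear subspace and $C, Y \in \mathbb{S}^n$. Let $\mathcal{M} \subseteq \mathbb{R}^{n\times n}$ be any *-subalgebra containing $Y + \mathcal{L} \subseteq \mathbb{S}^n$, and let $\mathcal{S} = \mathcal{M}\cap\mathbb{S}^n$. Then the orthogonal projection $P_{\mathcal{S}} : \mathbb{S}^n\to\mathbb{S}^n$ satisfies the Constraint Set Invariance Conditions for $(C,Y,\mathcal{L})$ and, in addition, the equality $P_{\mathcal{S}}(Y+\mathcal{L}) = Y+\mathcal{L}$.
   Context: $\mathbb{S}^n$ is the space of real symmetric $n\times n$ matrices with the trace inner product $X\cdot Y := \mathrm{Tr}(XY)$; $\mathbb{S}^n_+$ is the positive semidefinite cone; $P_{\mathcal{S}}$ denotes the orthogonal projection of $\mathbb{S}^n$ onto a subspace $\mathcal{S}$. $\mathbb{R}^{n\times n}$ is viewed as a *-algebra with matrix multiplication as product and transposition as *-involution; a *-subalgebra is a linear subspace closed under matrix multiplication and transposition (not required to contain the identity matrix). Constraint Set Invariance Conditions: $P_{\mathcal{S}}$ satisfies them if (a) $P_{\mathcal{S}}(\mathbb{S}^n_+)\subseteq \mathbb{S}^n_+$; (b) $P_{\mathcal{S}}(Y+\mathcal{L})\subseteq Y+\mathcal{L}$; (c) $P_{\mathcal{S}}(C+\mathcal{L}^\perp)\subseteq C+\mathcal{L}^\perp$. *)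

theory Defs
  imports "HOL-Analysis.Analysis"
begin

type_synonym 'n mat = "real ^ 'n ^ 'n"

definition sym_mats :: "'n::finite mat set"
  where "sym_mats = {X. transpose X = X}"

definition psd_cone :: "'n::finite mat set"
  where "psd_cone = {X \<in> sym_mats. \<forall>v. 0 \<le> v \<bullet> (X *v v)}"

definition trace_inner :: "'n::finite mat \<Rightarrow> 'n mat \<Rightarrow> real"
  where "trace_inner X Y = trace (X ** Y)"

(* On sym_mats this is the inner product of the library; on all square matrices the two differ. *)
lemma trace_inner_eq_inner:
  assumes "W \<in> sym_mats"
  shows "trace_inner X W = X \<bullet> W"
proof -
  have "W $ j $ i = W $ i $ j" for i j
    using assms by (simp add: sym_mats_def transpose_def vec_eq_iff)
  then show ?thesis
    by (simp add: trace_inner_def trace_def matrix_matrix_mult_def inner_vec_def)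
qed

(* The complement is taken inside sym_mats, not inside the space of all square matrices. *)
definition sym_orth :: "'n::finite mat set \<Rightarrow> 'n mat set"
  where "sym_orth L = {V \<in> sym_mats. \<forall>X\<in>L. trace_inner V X = 0}"

definition is_sym_subspace :: "'n::finite mat set \<Rightarrow> bool"
  where "is_sym_subspace S \<longleftrightarrow> subspace S \<and> S \<subseteq> sym_mats"

(* Meant for S a linear subspace of sym_mats, for which the description determines a
   unique matrix (see sym_proj_ex1), and for X in sym_mats. *)
definition sym_proj :: "'n::finite mat set \<Rightarrow> 'n mat \<Rightarrow> 'n mat"
  where "sym_proj S X = (THE Z. Z \<in> S \<and> (\<forall>W\<in>S. trace_inner (X - Z) W = 0))"

lemma sym_proj_ex1:
  assumes "is_sym_subspace S"
  shows "\<exists>!Z. Z \<in> S \<and> (\<forall>W\<in>S. trace_inner (X - Z) W = 0)"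
proof -
  have S: "subspace S" and sym: "\<And>W. W \<in> S \<Longrightarrow> W \<in> sym_mats"
    using assms by (auto simp: is_sym_subspace_def)
  have span: "span S = S" using S by simp
  obtain y z where "y \<in> span S" and "\<And>w. w \<in> span S \<Longrightarrow> orthogonal z w"
    and X: "X = y + z"
    using orthogonal_subspace_decomp_exists[of S X] by metis
  then have y: "y \<in> S" and z: "\<And>W. W \<in> S \<Longrightarrow> trace_inner (X - y) W = 0"
    using sym by (auto simp: span trace_inner_eq_inner orthogonal_def)
  show ?thesis
  proof (rule ex1I[of _ y])
    show "y \<in> S \<and> (\<forall>W\<in>S. trace_inner (X - y) W = 0)"
      using y z by blast
  next
    fix Z assume Z: "Z \<in> S \<and> (\<forall>W\<in>S. trace_inner (X - Z) W = 0)"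
    have d: "y - Z \<in> S"
      using Z y S by (auto intro: subspace_diff)
    have "(X - Z) \<bullet> (y - Z) = 0" "(X - y) \<bullet> (y - Z) = 0"
      using Z z[OF d] d trace_inner_eq_inner[OF sym[OF d]] by auto
    then have "(y - Z) \<bullet> (y - Z) = 0"
      by (simp add: inner_diff_left)
    then show "Z = y" by simp
  qed
qed

definition star_subalgebra :: "'n::finite mat set \<Rightarrow> bool"
  where "star_subalgebra M \<longleftrightarrow>
    subspace M \<and> (\<forall>A\<in>M. \<forall>B\<in>M. A ** B \<in> M) \<and> (\<forall>A\<in>M. transpose A \<in> M)"

definition constraint_set_invariance ::
    "('n::finite mat \<Rightarrow> 'n mat) \<Rightarrow> 'n mat \<Rightarrow> 'n mat \<Rightarrow> 'n mat set \<Rightarrow> bool"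
  where "constraint_set_invariance P C Y L \<longleftrightarrow>
    P ` psd_cone \<subseteq> psd_cone \<and>
    P ` ((+) Y ` L) \<subseteq> (+) Y ` L \<and>
    P ` ((+) C ` sym_orth L) \<subseteq> (+) C ` sym_orth L"

end

theory Submission
  imports Defs
begin

text \<open>
  Only positivity of the projection is not formal. Let \<open>X\<close> be positive semidefinite and
  \<open>Z = P\<^sub>S X\<close>. For \<open>A\<close> in \<open>M\<close> the matrix \<open>A A\<^sup>T\<close> lies in \<open>S\<close>, so
  \<open>A \<bullet> Z A = Z \<bullet> A A\<^sup>T = X \<bullet> A A\<^sup>T \<ge> 0\<close>: left multiplication by \<open>Z\<close> is a positive
  operator on the Euclidean space \<open>M\<close>. Hence for \<open>c < 0\<close> the operator \<open>A \<mapsto> (Z - c) A\<close> is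
  injective on \<open>M\<close>, therefore surjective, and \<open>(Z - c) E = Z\<close> for some \<open>E\<close> in \<open>M\<close>.
  If \<open>Z v = c v\<close>, transposing gives \<open>c v = Z v = E\<^sup>T (Z - c) v = 0\<close>, so \<open>v = 0\<close>.
  Thus \<open>Z\<close> has no negative eigenvalue. The algebra \<open>M\<close> need not contain the identity, which
  is why one solves for \<open>Z\<close> and not for the identity.
\<close>

lemma sym_mats_inner_commute:
  fixes Z :: "real ^ 'n::finite ^ 'n"
  assumes "Z \<in> sym_mats"
  shows "v \<bullet> (Z *v w) = (Z *v v) \<bullet> w"
  using assms by (simp add: sym_mats_def dot_lmul_matrix[symmetric] transpose_matrix_vector[symmetric])

lemma subspace_sym_mats: "subspace (sym_mats :: (real ^ 'n::finite ^ 'n) set)"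
  by (auto simp: subspace_def sym_mats_def transpose_def vec_eq_iff)

lemma subspace_sym_orth:
  fixes L :: "(real ^ 'n::finite ^ 'n) set"
  assumes "L \<subseteq> sym_mats"
  shows "subspace (sym_orth L)"
proof -
  have "trace_inner V X = X \<bullet> V" if "X \<in> L" for V X
    using that assms trace_inner_eq_inner[of X V] by (auto simp: inner_commute)
  then have "sym_orth L = sym_mats \<inter> {V. \<forall>X\<in>L. orthogonal X V}"
    unfolding sym_orth_def orthogonal_def by auto
  moreover have "subspace {V. \<forall>X\<in>L. orthogonal X V}"
    by (rule subspace_orthogonal_to_vectors)
  ultimately show ?thesis
    by (simp add: subspace_sym_mats subspace_inter)
qed

lemma mult_transpose_in_sym_mats: "A ** transpose A \<in> sym_mats"
  by (simp add: sym_mats_def matrix_transpose_mul)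

text \<open>Both sides are the trace of \<open>transpose A ** X ** A\<close>. This turns inner
  products with \<open>A ** transpose A\<close> into the quadratic form of left multiplication by
  \<open>X\<close>.\<close>

lemma inner_mult_left_eq:
  fixes A X :: "real ^ 'n::finite ^ 'n"
  shows "A \<bullet> (X ** A) = X \<bullet> (A ** transpose A)"
proof -
  have "A \<bullet> (X ** A) = (\<Sum>i\<in>UNIV. \<Sum>j\<in>UNIV. \<Sum>k\<in>UNIV. A $ i $ j * (X $ i $ k * A $ k $ j))"
    by (simp add: inner_vec_def matrix_matrix_mult_def sum_distrib_left)
  also have "\<dots> = (\<Sum>i\<in>UNIV. \<Sum>k\<in>UNIV. \<Sum>j\<in>UNIV. A $ i $ j * (X $ i $ k * A $ k $ j))"
    by (intro sum.cong refl sum.swap)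
  also have "\<dots> = X \<bullet> (A ** transpose A)"
    by (simp add: inner_vec_def matrix_matrix_mult_def transpose_def sum_distrib_left mult_ac)
  finally show ?thesis .
qed

text \<open>The inner product splits over the columns of \<open>A\<close>, each contributing a value
  of the quadratic form of \<open>X\<close>.\<close>

lemma psd_inner_mult_left_nonneg:
  fixes A X :: "real ^ 'n::finite ^ 'n"
  assumes "X \<in> psd_cone"
  shows "0 \<le> A \<bullet> (X ** A)"
proof -
  have "A \<bullet> (X ** A) = (\<Sum>i\<in>UNIV. \<Sum>j\<in>UNIV. A $ i $ j * (X ** A) $ i $ j)"
    by (simp add: inner_vec_def)
  also have "\<dots> = (\<Sum>j\<in>UNIV. \<Sum>i\<in>UNIV. A $ i $ j * (X ** A) $ i $ j)"
    by (rule sum.swap)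
  also have "\<dots> = (\<Sum>j\<in>UNIV. column j A \<bullet> (X *v column j A))"
    by (simp add: inner_vec_def column_def matrix_matrix_mult_def matrix_vector_mult_def)
  also have "0 \<le> \<dots>"
    using assms by (intro sum_nonneg) (simp add: psd_cone_def)
  finally show ?thesis .
qed

text \<open>By compactness the quadratic form of \<open>Z\<close> attains its minimum
  \<open>c\<close> on the unit sphere, and a minimizer is an eigenvector for
  \<open>c\<close>.\<close>

lemma psd_cone_if_no_negative_eigenvalue:
  fixes Z :: "real ^ 'n::finite ^ 'n"
  assumes sym: "Z \<in> sym_mats"
    and eig: "\<And>c v. c < 0 \<Longrightarrow> Z *v v = c *\<^sub>R v \<Longrightarrow> v = 0"
  shows "Z \<in> psd_cone"
proof -
  let ?S = "sphere (0 :: real ^ 'n) 1"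
  have "axis undefined 1 \<in> ?S" by simp
  then have "?S \<noteq> {}" by blast
  moreover have "continuous_on ?S (\<lambda>v. v \<bullet> (Z *v v))"
    by (intro continuous_intros linear_continuous_on matrix_vector_mul_bounded_linear)
  ultimately obtain v where v: "v \<in> ?S" and min: "\<And>w. w \<in> ?S \<Longrightarrow> v \<bullet> (Z *v v) \<le> w \<bullet> (Z *v w)"
    using continuous_attains_inf[of ?S "\<lambda>v. v \<bullet> (Z *v v)"] by auto
  define c where "c = v \<bullet> (Z *v v)"
  have low: "c * (w \<bullet> w) \<le> w \<bullet> (Z *v w)" for w
  proof (cases "w = 0")
    case False
    have "c \<le> (w /\<^sub>R norm w) \<bullet> (Z *v (w /\<^sub>R norm w))"
      unfolding c_def using False by (intro min) simp
    also have "\<dots> = (w \<bullet> (Z *v w)) / (w \<bullet> w)"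
      by (simp add: matrix_vector_mult_scaleR divide_inverse dot_square_norm power2_eq_square mult_ac)
    finally show ?thesis
      using False by (simp add: pos_le_divide_eq)
  qed simp
  define u where "u = Z *v v - c *\<^sub>R v"
  define q where "q = u \<bullet> (Z *v u) - c * (u \<bullet> u)"
  have vv: "v \<bullet> v = 1" using v by (simp add: dot_square_norm)
  have "0 \<le> q" using low[of u] by (simp add: q_def)
  txt \<open>The nonnegative form \<open>w \<bullet> (Z - c) w\<close> vanishes at \<open>v\<close>; going a small step along its
    gradient \<open>2 u\<close> would make it negative.\<close>
  define t where "t = - (u \<bullet> u) / (q + 1)"
  have "u \<bullet> (Z *v v) - c * (u \<bullet> v) = u \<bullet> u"
    by (simp add: u_def inner_diff_right)
  moreover have "v \<bullet> (Z *v u) = u \<bullet> (Z *v v)"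
    using sym_mats_inner_commute[OF sym, of v u] by (simp add: inner_commute)
  ultimately have "(v + t *\<^sub>R u) \<bullet> (Z *v (v + t *\<^sub>R u)) - c * ((v + t *\<^sub>R u) \<bullet> (v + t *\<^sub>R u))
      = 2 * t * (u \<bullet> u) + t\<^sup>2 * q"
    unfolding q_def using vv c_def
    by (simp add: matrix_vector_mult_scaleR matrix_vector_right_distrib inner_add_left
        inner_add_right inner_commute[of v u] algebra_simps power2_eq_square)
  then have "0 \<le> 2 * t * (u \<bullet> u) + t\<^sup>2 * q"
    using low[of "v + t *\<^sub>R u"] by simp
  \<comment> \<open>The \<open>+ 1\<close> in \<open>t\<close> keeps the denominator positive when
    \<open>q = 0\<close>. As \<open>q + 2\<close> is positive, the value is negative unless
    \<open>u = 0\<close>.\<close>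
  also have "\<dots> = - ((u \<bullet> u)\<^sup>2 * (q + 2)) / (q + 1)\<^sup>2"
    unfolding t_def using \<open>0 \<le> q\<close> by (simp add: divide_simps) (simp add: power2_eq_square algebra_simps)
  finally have "(u \<bullet> u)\<^sup>2 * (q + 2) \<le> 0"
    using \<open>0 \<le> q\<close> by (simp add: divide_le_0_iff)
  then have "u = 0"
    using \<open>0 \<le> q\<close> by (simp add: mult_le_0_iff)
  then have "Z *v v = c *\<^sub>R v" by (simp add: u_def)
  then have "0 \<le> c" using eig[of c v] vv by force
  then show ?thesis
    using sym low by (auto simp: psd_cone_def intro: order_trans[OF _ low])
qed

lemma star_subalgebra_no_negative_eigenvalue:
  fixes M :: "(real ^ 'n::finite ^ 'n) set"
  assumes M: "star_subalgebra M" and Z: "Z \<in> M" "Z \<in> sym_mats"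
    and pos: "\<And>A. A \<in> M \<Longrightarrow> 0 \<le> A \<bullet> (Z ** A)"
    and c: "c < 0" and v: "Z *v v = c *\<^sub>R v"
  shows "v = 0"
proof -
  have sub: "subspace M" and mul: "\<And>A. A \<in> M \<Longrightarrow> Z ** A \<in> M"
    using M Z by (auto simp: star_subalgebra_def)
  \<comment> \<open>Left multiplication by \<open>Z\<close> minus \<open>c\<close> times the
    identity, expanded so that each term stays in \<open>M\<close> even if the identity is not
    there.\<close>
  define f where "f A = Z ** A - c *\<^sub>R A" for A :: "real ^ 'n ^ 'n"
  have lin: "linear f"
    by (rule linearI) (simp_all add: f_def vec_eq_iff matrix_matrix_mult_def sum.distrib
        sum_distrib_left algebra_simps)
  have fM: "f ` M \<subseteq> M"
    using sub mul by (auto simp: f_def intro: subspace_diff subspace_scale)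
  \<comment> \<open>A kernel element has \<open>Z ** A = c *\<^sub>R A\<close>, so
    \<open>pos\<close> bounds \<open>c * (A \<bullet> A)\<close> below by zero although
    \<open>c < 0\<close>.\<close>
  have "A = 0" if "A \<in> M" "f A = 0" for A
  proof -
    have "0 \<le> c * (A \<bullet> A)"
      using pos[OF that(1)] that(2) by (simp add: f_def)
    then show ?thesis
      using c by (simp add: zero_le_mult_iff) (metis inner_gt_zero_iff less_le_not_le)
  qed
  then have "inj_on f M"
    using linear_injective_on_subspace_0[OF lin sub] by blast
  then have "dim (f ` M) = dim M"
    using dim_image_eq[OF lin, of M] sub by (metis span_eq_iff)
  then have "f ` M = M"
    using subspace_dim_equal[OF linear_subspace_image[OF lin sub] sub fM] by simp
  then obtain E where E: "f E = Z" using Z(1) by (metis imageE)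
  \<comment> \<open>Here \<open>Z *v w\<close> is \<open>Z\<close> minus \<open>c\<close> applied to
    \<open>E *v w\<close>; symmetry moves that operator onto \<open>v\<close>, which it
    annihilates.\<close>
  have "w \<bullet> (Z *v v) = 0" for w
  proof -
    have "w \<bullet> (Z *v v) = (Z *v w) \<bullet> v" by (rule sym_mats_inner_commute[OF Z(2)])
    also have "Z *v w = Z *v (E *v w) - c *\<^sub>R (E *v w)"
      by (subst E[symmetric]) (simp add: f_def matrix_vector_mult_diff_rdistrib
          matrix_vector_mul_assoc scaleR_matrix_vector_assoc)
    also have "\<dots> \<bullet> v = 0"
      using sym_mats_inner_commute[OF Z(2), of "E *v w" v] v by (simp add: inner_diff_left)
    finally show ?thesis .
  qed
  then have "Z *v v = 0" by (metis inner_eq_zero_iff)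
  then show ?thesis using v c by simp
qed

lemma sym_proj_in:
  assumes "is_sym_subspace S"
  shows "sym_proj S X \<in> S"
  using theI'[OF sym_proj_ex1[OF assms, of X]] by (simp add: sym_proj_def)

lemma sym_proj_orth:
  assumes "is_sym_subspace S" and "W \<in> S"
  shows "trace_inner (X - sym_proj S X) W = 0"
  using theI'[OF sym_proj_ex1[OF assms(1), of X]] assms(2) by (simp add: sym_proj_def)

lemma sym_proj_ident:
  assumes "is_sym_subspace S" and "X \<in> S"
  shows "sym_proj S X = X"
  unfolding sym_proj_def
  by (rule the1_equality[OF sym_proj_ex1[OF assms(1)]])
    (use assms(2) in \<open>simp add: trace_inner_def trace_def\<close>)

text \<open>Every \<open>A ** transpose A\<close> with \<open>A\<close> in \<open>M\<close> is a
  symmetric test matrix in \<open>M\<close>, on which \<open>X\<close> and its projection agree; so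
  positivity passes from \<open>X\<close> to the projection.\<close>

lemma sym_proj_psd:
  fixes M :: "(real ^ 'n::finite ^ 'n) set"
  assumes M: "star_subalgebra M" and S: "is_sym_subspace (M \<inter> sym_mats)"
    and X: "X \<in> psd_cone"
  shows "sym_proj (M \<inter> sym_mats) X \<in> psd_cone"
proof -
  define Z where "Z = sym_proj (M \<inter> sym_mats) X"
  have Z: "Z \<in> M" "Z \<in> sym_mats"
    using sym_proj_in[OF S, of X] by (auto simp: Z_def)
  have "0 \<le> A \<bullet> (Z ** A)" if "A \<in> M" for A
  proof -
    have "A ** transpose A \<in> M \<inter> sym_mats"
      using M that mult_transpose_in_sym_mats by (auto simp: star_subalgebra_def)
    from sym_proj_orth[OF S this, of X] have "X \<bullet> (A ** transpose A) = Z \<bullet> (A ** transpose A)"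
      by (simp add: trace_inner_eq_inner[OF mult_transpose_in_sym_mats] Z_def inner_diff_left)
    then show ?thesis
      using psd_inner_mult_left_nonneg[OF X, of A] by (simp add: inner_mult_left_eq)
  qed
  then show ?thesis
    using psd_cone_if_no_negative_eigenvalue[OF Z(2)]
      star_subalgebra_no_negative_eigenvalue[OF M Z] unfolding Z_def by blast
qed

theorem proposition2p5:
  fixes L M S :: "(real ^ 'n::finite ^ 'n) set"
    and C Y :: "real ^ 'n ^ 'n"
  assumes "is_sym_subspace L"
    and "C \<in> sym_mats" and "Y \<in> sym_mats"
    and "star_subalgebra M"
    and "(+) Y ` L \<subseteq> M"
    and "S = M \<inter> sym_mats"
  shows "constraint_set_invariance (sym_proj S) C Y L \<and>
    sym_proj S ` ((+) Y ` L) = (+) Y ` L"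
proof -
  have L: "subspace L" "L \<subseteq> sym_mats" and M: "subspace M"
    using assms by (auto simp: is_sym_subspace_def star_subalgebra_def)
  have S: "is_sym_subspace S"
    using M subspace_sym_mats by (auto simp: is_sym_subspace_def assms(6) intro: subspace_inter)
  have YL: "(+) Y ` L \<subseteq> S"
    using assms L subspace_sym_mats by (auto intro: subspace_add)
  then have fix_YL: "sym_proj S ` ((+) Y ` L) = (+) Y ` L"
    using sym_proj_ident[OF S] by (force simp: image_iff)
  \<comment> \<open>An element of \<open>L\<close> is the difference of two points of the translate
    by \<open>Y\<close>, one of them \<open>Y\<close> itself.\<close>
  have "L \<subseteq> S"
  proof
    fix X assume "X \<in> L"
    then have "Y + X \<in> S" "Y + 0 \<in> S"
      using YL subspace_0[OF L(1)] by blast+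
    then show "X \<in> S"
      using S subspace_diff[of S "Y + X" Y] by (simp add: is_sym_subspace_def)
  qed
  \<comment> \<open>The residual \<open>?D\<close> is orthogonal to \<open>S\<close>, hence to
    \<open>L\<close>; subtracting it moves \<open>C + V\<close> only within its translate of
    \<open>sym_orth L\<close>.\<close>
  have "sym_proj S (C + V) \<in> (+) C ` sym_orth L" if V: "V \<in> sym_orth L" for V
  proof -
    let ?D = "C + V - sym_proj S (C + V)"
    have "C + V \<in> sym_mats" "sym_proj S (C + V) \<in> sym_mats"
      using V assms(2,6) sym_proj_in[OF S, of "C + V"] subspace_sym_mats
      by (auto simp: sym_orth_def intro: subspace_add)
    then have "?D \<in> sym_orth L"
      using sym_proj_orth[OF S, of _ "C + V"] \<open>L \<subseteq> S\<close> subspace_sym_mats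
      by (auto simp: sym_orth_def intro: subspace_diff)
    then have "V - ?D \<in> sym_orth L"
      by (rule subspace_diff[OF subspace_sym_orth[OF L(2)] V])
    moreover have "sym_proj S (C + V) = C + (V - ?D)" by simp
    ultimately show ?thesis by (metis imageI)
  qed
  then have "sym_proj S ` ((+) C ` sym_orth L) \<subseteq> (+) C ` sym_orth L"
    by blast
  moreover have "sym_proj S ` psd_cone \<subseteq> psd_cone"
    using sym_proj_psd[OF assms(4)] S unfolding assms(6) by blast
  ultimately show ?thesis
    unfolding constraint_set_invariance_def fix_YL by simp
qed

end
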